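(* Suppose we are given an example $\mathbf{x}\in\mathbb{R}^d$, an arbitrary base classifier $f:\mathbb{R}^d\to\{1,2,\dots,c\}$, $\epsilon\sim\mathcal{N}(0,\sigma^2 I)$, the smoothed classifier $g_k$ of $f$, an arbitrary label $l\in\{1,2,\dots,c\}$, and numbers $\underline{p_l},\overline{p}_1,\dots,\overline{p}_{l-1},\overline{p}_{l+1},\dots,\overline{p}_c\in[0,1]$ that satisfy $$\Pr(f(\mathbf{x}+\epsilon)=l)\ge \underline{p_l}\quad\text{and}\quad \Pr(f(\mathbf{x}+\epsilon)=i)\le\overline{p}_i\ \ \forall i\ne l.$$ Let $\overline{p}_{b_k}\ge\overline{p}_{b_{k-1}}\ge\cdots\ge\overline{p}_{b_1}$ be the $k$ largest ones among $\{\overline{p}_1,\dots,\overline{p}_{l-1},\overline{p}_{l+1},\dots,\overline{p}_c\}$, where ties are broken uniformly at random. For $t=1,2,\dots,k$ let $S_t=\{b_1,b_2,\dots,b_t\}$ be the set of $t$ labels with the smallest probability upper bounds among these $k$ largest ones, and let $\overline{p}_{S_t}=\sum_{j=1}^t\overline{p}_{b_j}$ be the sum of these $t$ upper bounds. Then $$l\in g_k(\mathbf{x}+\delta)\quad\text{for all }\delta\in\mathbb{R}^d\text{ with }\|\delta\|_2<R_l,$$ where $R_l$ is the unique solution to the equation $$\Phi\Big(\Phi^{-1}(\underline{p_l})-\frac{R_l}{\sigma}\Big)-\min_{1\le t\le k}\frac{\Phi\big(\Phi^{-1}(\overline{p}_{S_t})+\frac{R_l}{\sigma}\big)}{t}=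0.$$
   Context: $\sigma>0$ is the noise standard deviation, $c$ is the number of labels and $k$ is the number of predicted labels. $\Phi$ and $\Phi^{-1}$ are the cumulative distribution function of the standard Gaussian distribution on $\mathbb{R}$ and its inverse. For a base classifier $f$ and a point $\mathbf{z}\in\mathbb{R}^d$, the smoothed classifier $g_k(\mathbf{z})$ returns the set of the $k$ labels $i\in\{1,\dots,c\}$ with the largest probabilities $\Pr(f(\mathbf{z}+\epsilon)=i)$, where $\epsilon\sim\mathcal{N}(0,\sigma^2 I)$.
   Formalization: A unique solution R_l is claimed only for 0<p_l<1, p_{b_1}>0 and, if k=1, p_{b_1}<1 (otherwise there is none or every real solves it); the certification holds whenever R_l is the unique solution. Φ^{-1} is −∞ at 0 and +∞ at values ≥1, including sums p_{S_t}>1. *)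

theory Defs
  imports "HOL-Probability.Probability"
begin

text \<open>Standard Gaussian distribution function, extended by its limits at \<open>\<plusminus>\<infinity>\<close>.\<close>

fun std_normal_cdf :: "ereal \<Rightarrow> real" where
  "std_normal_cdf (ereal x) = cdf std_normal_distribution x"
| "std_normal_cdf PInfty = 1"
| "std_normal_cdf MInfty = 0"

text \<open>The inverse is extended-real valued because probability bounds may equal 0 or 1.
  A sum of upper bounds on probabilities may exceed 1 and is then as uninformative as the
  bound 1, so that such arguments are mapped to \<open>\<infinity>\<close> as well.\<close>

definition std_normal_quantile :: "real \<Rightarrow> ereal" where
  "std_normal_quantile p =
     (if p \<le> 0 then -\<infinity> else if p \<ge> 1 then \<infinity>
      else ereal (inv (cdf std_normal_distribution) p))"

definition isotropic_gaussian :: "real \<Rightarrow> (real ^ 'd) measure" where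
  "isotropic_gaussian \<sigma> =
     density lborel (\<lambda>e. ennreal (\<Prod>i\<in>UNIV. normal_density 0 \<sigma> (e $ i)))"

definition label_prob :: "real \<Rightarrow> (real ^ 'd \<Rightarrow> nat) \<Rightarrow> real ^ 'd \<Rightarrow> nat \<Rightarrow> real" where
  "label_prob \<sigma> f z i = measure (isotropic_gaussian \<sigma>) {e. f (z + e) = i}"

text \<open>\<open>T\<close> consists of \<open>k\<close> elements of \<open>A\<close> with the largest values of \<open>p\<close>. In the presence of
  ties several sets \<open>T\<close> qualify; each of them is the outcome of some tie breaking.\<close>

definition is_top_k :: "nat \<Rightarrow> nat set \<Rightarrow> (nat \<Rightarrow> real) \<Rightarrow> nat set \<Rightarrow> bool" where
  "is_top_k k A p T \<longleftrightarrow>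
     T \<subseteq> A \<and> finite T \<and> card T = k \<and> (\<forall>i\<in>T. \<forall>j\<in>A - T. p j \<le> p i)"

definition is_smoothed_classifier ::
    "real \<Rightarrow> nat \<Rightarrow> nat \<Rightarrow> (real ^ 'd \<Rightarrow> nat) \<Rightarrow> (real ^ 'd \<Rightarrow> nat set) \<Rightarrow> bool" where
  "is_smoothed_classifier \<sigma> c k f g \<longleftrightarrow> (\<forall>z. is_top_k k {1..c} (label_prob \<sigma> f z) (g z))"

text \<open>\<open>b 1, \<dots>, b k\<close> enumerate, in nondecreasing order of \<open>p\<close> and with ties broken arbitrarily,
  \<open>k\<close> elements of \<open>A\<close> with the largest values of \<open>p\<close>.\<close>

definition is_top_k_enum :: "nat \<Rightarrow> nat set \<Rightarrow> (nat \<Rightarrow> real) \<Rightarrow> (nat \<Rightarrow> nat) \<Rightarrow> bool" where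
  "is_top_k_enum k A p b \<longleftrightarrow>
     inj_on b {1..k} \<and> is_top_k k A p (b ` {1..k}) \<and> mono_on {1..k} (\<lambda>j. p (b j))"

definition radius_gap ::
    "real \<Rightarrow> nat \<Rightarrow> real \<Rightarrow> (nat \<Rightarrow> real) \<Rightarrow> (nat \<Rightarrow> nat) \<Rightarrow> real \<Rightarrow> real" where
  "radius_gap \<sigma> k p_low p_up b R =
     std_normal_cdf (std_normal_quantile p_low - ereal (R / \<sigma>))
     - Min ((\<lambda>t. std_normal_cdf
                   (std_normal_quantile (\<Sum>j=1..t. p_up (b j)) + ereal (R / \<sigma>)) / real t)
            ` {1..k})"

end

theory Submission
  imports Defs "HOL-Real_Asymp.Real_Asymp"
begin

text \<open>Let \<open>r = norm \<delta>\<close>. Among all sets of given Gaussian probability \<open>\<Phi>(a)\<close>, the half-spaces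
  orthogonal to \<open>\<delta>\<close> are extremal for the shifted Gaussian (Neyman--Pearson), since the likelihood
  ratio is monotone in \<open>\<delta> \<bullet> z\<close>; hence a shift by \<open>\<delta>\<close> moves the probability of a set by at most
  \<open>\<Phi>(a) \<mapsto> \<Phi>(a \<plusminus> r/\<sigma>)\<close>. If \<open>l\<close> were missing from the top \<open>k\<close> labels at \<open>x + \<delta>\<close>, then for each \<open>t\<close>
  there would be \<open>t\<close> labels, each at least as probable as \<open>l\<close> at \<open>x + \<delta>\<close>, whose upper bounds sum to at
  most that of \<open>S\<^sub>t\<close>; so \<open>t\<close> times the lower bound for \<open>l\<close> would not exceed the upper bound for \<open>S\<^sub>t\<close>.
  But the gap is strictly decreasing in the radius, hence positive at \<open>r < R\<^sub>l\<close>, which contradicts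
  this for the \<open>t\<close> attaining the minimum.\<close>

subsection \<open>The standard normal distribution function\<close>

abbreviation std_cdf :: "real \<Rightarrow> real" where
  "std_cdf \<equiv> cdf std_normal_distribution"

interpretation std_normal: real_distribution std_normal_distribution
  by (rule real_dist_normal_dist)

lemma isCont_std_cdf: "isCont std_cdf x"
proof -
  have "emeasure std_normal_distribution {x} = (\<integral>\<^sup>+y. ennreal (std_normal_density y) * indicator {x} y \<partial>lborel)"
    by (simp add: emeasure_density)
  also have "\<dots> = 0"
    using AE_lborel_singleton[of x] by (subst nn_integral_0_iff_AE) (auto elim!: eventually_mono)
  finally show ?thesis
    by (simp add: std_normal.isCont_cdf measure_def)
qed

text \<open>The density is positive everywhere, so an interval that is null for the Gaussian would
  be null for Lebesgue measure as well.\<close>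

lemma strict_mono_std_cdf: "strict_mono std_cdf"
proof (rule strict_monoI)
  fix x y :: real assume "x < y"
  have "emeasure std_normal_distribution {x<..y} \<noteq> 0"
  proof
    assume "emeasure std_normal_distribution {x<..y} = 0"
    then have "(\<integral>\<^sup>+z. ennreal (std_normal_density z) * indicator {x<..y} z \<partial>lborel) = 0"
      by (simp add: emeasure_density)
    then have "AE z in lborel. z \<notin> {x<..y}"
      by (subst (asm) nn_integral_0_iff_AE)
         (auto elim!: eventually_mono simp: indicator_def split: if_splits,
          metis normal_density_pos less_numeral_extra(1) less_le_not_le)
    then have "emeasure lborel {x<..y} = 0"
      by (subst (asm) AE_iff_measurable[where N = "{x<..y}"]) auto
    then show False using \<open>x < y\<close> by simp
  qed
  then have "0 < measure std_normal_distribution {x<..y}"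
    by (simp add: std_normal.emeasure_eq_measure zero_less_measure_iff)
  then show "std_cdf x < std_cdf y"
    using std_normal.cdf_diff_eq[OF \<open>x < y\<close>] by simp
qed

lemmas std_cdf_less_iff [simp] = strict_mono_less[OF strict_mono_std_cdf]
lemmas std_cdf_le_iff [simp] = strict_mono_less_eq[OF strict_mono_std_cdf]

lemma std_cdf_pos: "0 < std_cdf x" and std_cdf_less_1: "std_cdf x < 1"
proof -
  have "std_cdf (x - 1) < std_cdf x" "std_cdf x < std_cdf (x + 1)" by simp_all
  then show "0 < std_cdf x" "std_cdf x < 1"
    using std_normal.cdf_nonneg[of "x - 1"] std_normal.cdf_bounded_prob[of "x + 1"] by linarith+
qed

text \<open>\<open>inv\<close> is only a right inverse on the range of \<open>std_cdf\<close>. The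
  limits 0 and 1 at the two ends and the intermediate value theorem put every \<open>p\<close>
  strictly between 0 and 1 into that range.\<close>

lemma std_cdf_quantile:
  assumes "0 < p" "p < 1"
  obtains a where "std_normal_quantile p = ereal a" "std_cdf a = p"
proof -
  have "eventually (\<lambda>x. std_cdf x < p) at_bot"
    using std_normal.cdf_lim_at_bot assms(1) by (rule order_tendstoD)
  then obtain x where x: "std_cdf x < p" by (auto dest: eventually_happens)
  have "eventually (\<lambda>x. p < std_cdf x) at_top"
    using std_normal.cdf_lim_at_top_prob assms(2) by (rule order_tendstoD)
  then obtain y where y: "p < std_cdf y" by (auto dest: eventually_happens)
  have "x \<le> y" using less_trans[OF x y] by simp
  with x y obtain a where "std_cdf a = p"
    using IVT[of std_cdf x p y] isCont_std_cdf by auto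
  then have "std_cdf (inv std_cdf p) = p" by (metis f_inv_into_f rangeI)
  then show ?thesis using that assms by (auto simp: std_normal_quantile_def)
qed

subsection \<open>Shifts of the isotropic Gaussian\<close>

text \<open>The product of \<open>indicator B - indicator A\<close> and \<open>q - c * p\<close> is
  nonnegative everywhere: on \<open>B - A\<close> both factors are at least 0, on
  \<open>A - B\<close> both are at most 0. Integrate it and use \<open>0 \<le> c\<close>. Either
  \<open>A\<close> or \<open>B\<close> can be the likelihood-ratio region, so the lemma yields both
  upper and lower bounds.\<close>

lemma neyman_pearson:
  fixes p q :: "'a \<Rightarrow> real"
  assumes "integrable M p" "integrable M q" "A \<in> sets M" "B \<in> sets M" "0 \<le> c"
    and A: "\<And>x. x \<in> A - B \<Longrightarrow> q x \<le> c * p x"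
    and B: "\<And>x. x \<in> B - A \<Longrightarrow> c * p x \<le> q x"
    and le: "(LINT x:A|M. p x) \<le> (LINT x:B|M. p x)"
  shows "(LINT x:A|M. q x) \<le> (LINT x:B|M. q x)"
proof -
  note [simp] = set_integrable_def set_lebesgue_integral_def
  have int: "set_integrable M S h" if "integrable M h" "S \<in> sets M" for h :: "'a \<Rightarrow> real" and S
    using that integrable_mult_indicator[of S M h] by simp
  have "0 \<le> (LINT x|M. (indicator B x - indicator A x) * (q x - c * p x))"
    using A B by (intro integral_nonneg_AE AE_I2) (auto simp: indicator_def)
  also have "\<dots> = (LINT x|M. (indicator B x * q x - indicator A x * q x)
                     - c * (indicator B x * p x - indicator A x * p x))"
    by (simp add: algebra_simps)
  also have "\<dots> = ((LINT x:B|M. q x) - (LINT x:A|M. q x))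
                     - c * ((LINT x:B|M. p x) - (LINT x:A|M. p x))"
    using int[OF assms(1,3)] int[OF assms(1,4)] int[OF assms(2,3)] int[OF assms(2,4)] by simp
  finally have "c * ((LINT x:B|M. p x) - (LINT x:A|M. p x)) \<le> (LINT x:B|M. q x) - (LINT x:A|M. q x)"
    by simp
  moreover have "0 \<le> c * ((LINT x:B|M. p x) - (LINT x:A|M. p x))"
    using \<open>0 \<le> c\<close> le by simp
  ultimately show ?thesis by linarith
qed

section \<open>Coordinates of the isotropic Gaussian as independent normal variables\<close>

definition isotropic_density :: "real \<Rightarrow> real ^ 'd \<Rightarrow> real" where
  "isotropic_density \<sigma> z = (\<Prod>i\<in>UNIV. normal_density 0 \<sigma> (z $ i))"

lemma isotropic_gaussian_eq: "isotropic_gaussian \<sigma> = density lborel (isotropic_density \<sigma>)"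
  by (simp add: isotropic_gaussian_def isotropic_density_def)

lemma isotropic_density_measurable [measurable]: "isotropic_density \<sigma> \<in> borel_measurable borel"
  unfolding isotropic_density_def[abs_def] by measurable

lemma isotropic_density_nonneg [simp]: "0 \<le> isotropic_density \<sigma> z"
  by (simp add: isotropic_density_def prod_nonneg)

lemma space_isotropic_gaussian [simp]: "space (isotropic_gaussian \<sigma>) = UNIV"
  and sets_isotropic_gaussian [simp, measurable_cong]: "sets (isotropic_gaussian \<sigma>) = sets borel"
  by (simp_all add: isotropic_gaussian_def)

text \<open>Fubini in the form \<open>nn_integral_lborel_prod\<close> ranges over
  \<open>Basis\<close>, whose elements are here the vectors \<open>axis i 1\<close>. The map
  \<open>idx\<close> recovers the coordinate from the basis vector, and reindexing gives products
  over coordinates.\<close>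

lemma nn_integral_lborel_vec_prod:
  fixes h :: "'d::finite \<Rightarrow> real \<Rightarrow> real"
  assumes "\<And>i. h i \<in> borel_measurable borel" "\<And>i x. 0 \<le> h i x"
  shows "(\<integral>\<^sup>+z. ennreal (\<Prod>i\<in>UNIV. h i (z $ i)) \<partial>lborel) = (\<Prod>i\<in>UNIV. \<integral>\<^sup>+x. ennreal (h i x) \<partial>lborel)"
proof -
  define idx :: "real ^ 'd \<Rightarrow> 'd" where "idx = inv (\<lambda>i. axis i 1)"
  have inj: "inj (\<lambda>i::'d. axis i (1::real))" by (auto simp: inj_on_def axis_eq_axis)
  have idx: "idx (axis i 1) = i" for i unfolding idx_def by (rule inv_f_f[OF inj])
  have B: "(Basis :: (real ^ 'd) set) = (\<lambda>i. axis i 1) ` UNIV" by (auto simp: Basis_vec_def)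
  have prod_B: "(\<Prod>b\<in>(Basis :: (real ^ 'd) set). F b) = (\<Prod>i\<in>UNIV. F (axis i 1))"
    for F :: "real ^ 'd \<Rightarrow> 'z::comm_monoid_mult"
    unfolding B by (subst prod.reindex[OF inj]) simp
  have "(\<integral>\<^sup>+z. ennreal (\<Prod>i\<in>UNIV. h i (z $ i)) \<partial>lborel)
      = (\<integral>\<^sup>+z. (\<Prod>b\<in>Basis. ennreal (h (idx b) (z \<bullet> b))) \<partial>lborel)"
    by (simp add: prod_B idx inner_axis prod_ennreal assms)
  also have "\<dots> = (\<Prod>b\<in>(Basis :: (real ^ 'd) set). \<integral>\<^sup>+x. ennreal (h (idx b) x) \<partial>lborel)"
    using assms by (intro nn_integral_lborel_prod) auto
  finally show ?thesis by (simp add: prod_B idx)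
qed

context
  fixes \<sigma> :: real
  assumes \<sigma>: "0 < \<sigma>"
begin

lemma prob_space_isotropic_gaussian: "prob_space (isotropic_gaussian \<sigma> :: (real ^ 'd) measure)"
proof
  have "(\<integral>\<^sup>+x. ennreal (normal_density 0 \<sigma> x) \<partial>lborel) = 1"
    using prob_space.emeasure_space_1[OF prob_space_normal_density[OF \<sigma>, of 0]]
    by (simp add: emeasure_density)
  then show "emeasure (isotropic_gaussian \<sigma> :: (real ^ 'd) measure) (space (isotropic_gaussian \<sigma>)) = 1"
    using nn_integral_lborel_vec_prod[where 'd = 'd, of "\<lambda>_. normal_density 0 \<sigma>"]
    by (simp add: isotropic_gaussian_def emeasure_density)
qed

text \<open>A product measure is determined by its values on boxes, and on a box both the density
  and the indicator factor over the coordinates. The marginals and the independence of the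
  coordinates follow from this.\<close>

lemma distr_isotropic_gaussian_PiM:
  "distr (isotropic_gaussian \<sigma>) (\<Pi>\<^sub>M i\<in>UNIV. borel) (\<lambda>z i. z $ i)
     = (\<Pi>\<^sub>M i\<in>(UNIV :: 'd::finite set). density lborel (normal_density 0 \<sigma>))"
proof -
  interpret N: prob_space "density lborel (normal_density 0 \<sigma>)"
    using \<sigma> by (rule prob_space_normal_density)
  interpret product_sigma_finite "\<lambda>_ :: 'd. density lborel (normal_density 0 \<sigma>)"
    by standard
  show ?thesis
  proof (rule PiM_eqI)
    show "sets (distr (isotropic_gaussian \<sigma>) (\<Pi>\<^sub>M i\<in>(UNIV :: 'd set). borel) (\<lambda>z i. z $ i))
        = sets (\<Pi>\<^sub>M i\<in>(UNIV :: 'd set). density lborel (normal_density 0 \<sigma>))"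
      by (simp cong: sets_PiM_cong)
    fix A :: "'d \<Rightarrow> real set"
    assume "\<And>i. i \<in> UNIV \<Longrightarrow> A i \<in> sets (density lborel (normal_density 0 \<sigma>))"
    then have [measurable]: "A i \<in> sets borel" for i by simp
    have ind: "(\<Prod>i\<in>UNIV. indicator (A i) (z $ i)) = (indicator {z. \<forall>i. z $ i \<in> A i} z :: real)" for z
      by (auto simp: indicator_def)
    have M: "(\<lambda>z i. z $ i) \<in> isotropic_gaussian \<sigma> \<rightarrow>\<^sub>M (\<Pi>\<^sub>M i\<in>(UNIV :: 'd set). borel)"
      by (rule measurable_PiM_single') auto
    have "Pi\<^sub>E UNIV A \<in> sets (\<Pi>\<^sub>M i\<in>(UNIV :: 'd set). borel)"
      by (rule sets_PiM_I_finite) auto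
    then have "emeasure (distr (isotropic_gaussian \<sigma>) (\<Pi>\<^sub>M i\<in>(UNIV :: 'd set). borel) (\<lambda>z i. z $ i)) (Pi\<^sub>E UNIV A)
        = emeasure (isotropic_gaussian \<sigma>) {z. \<forall>i. z $ i \<in> A i}"
      by (subst emeasure_distr[OF M]) (auto intro!: arg_cong2[where f = emeasure])
    also have "\<dots> = (\<integral>\<^sup>+z. ennreal (\<Prod>i\<in>UNIV. normal_density 0 \<sigma> (z $ i) * indicator (A i) (z $ i)) \<partial>lborel)"
      unfolding isotropic_gaussian_def
      by (subst emeasure_density)
         (auto intro!: nn_integral_cong simp: prod.distrib ind ennreal_mult'' ennreal_indicator)
    also have "\<dots> = (\<Prod>i\<in>UNIV. \<integral>\<^sup>+x. ennreal (normal_density 0 \<sigma> x * indicator (A i) x) \<partial>lborel)"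
      by (rule nn_integral_lborel_vec_prod) auto
    also have "\<dots> = (\<Prod>i\<in>UNIV. emeasure (density lborel (normal_density 0 \<sigma>)) (A i))"
      by (intro prod.cong refl)
         (simp add: emeasure_density ennreal_mult' ennreal_indicator)
    finally show "emeasure (distr (isotropic_gaussian \<sigma>) (\<Pi>\<^sub>M i\<in>(UNIV :: 'd set). borel) (\<lambda>z i. z $ i)) (Pi\<^sub>E UNIV A)
        = (\<Prod>i\<in>UNIV. emeasure (density lborel (normal_density 0 \<sigma>)) (A i))" .
  qed simp
qed

lemma distributed_isotropic_gaussian_component:
  "distributed (isotropic_gaussian \<sigma>) lborel (\<lambda>z. z $ i) (normal_density 0 \<sigma>)"
proof -
  have "distr (isotropic_gaussian \<sigma>) borel (\<lambda>z. z $ i)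
      = distr (distr (isotropic_gaussian \<sigma>) (\<Pi>\<^sub>M i\<in>UNIV. borel) (\<lambda>z i. z $ i)) borel (\<lambda>w. w i)"
    by (subst distr_distr) (auto simp: comp_def intro!: measurable_PiM_single')
  also have "\<dots> = distr (\<Pi>\<^sub>M i\<in>UNIV. density lborel (normal_density 0 \<sigma>))
                      (density lborel (normal_density 0 \<sigma>)) (\<lambda>w. w i)"
    unfolding distr_isotropic_gaussian_PiM by (rule distr_cong) auto
  also have "\<dots> = density lborel (normal_density 0 \<sigma>)"
    by (rule distr_PiM_component) (auto intro: prob_space_normal_density \<sigma>)
  finally show ?thesis
    by (simp add: distributed_def cong: distr_cong)
qed

lemma indep_vars_isotropic_gaussian:
  "prob_space.indep_vars (isotropic_gaussian \<sigma>) (\<lambda>_. borel) (\<lambda>i z. z $ i) UNIV"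
proof -
  interpret prob_space "isotropic_gaussian \<sigma>" by (rule prob_space_isotropic_gaussian)
  have "distr (isotropic_gaussian \<sigma>) borel (\<lambda>z. z $ i) = density lborel (normal_density 0 \<sigma>)" for i :: 'a
    using distributed_distr_eq_density[OF distributed_isotropic_gaussian_component[of i]]
    by (simp cong: distr_cong)
  then show ?thesis
    using distr_isotropic_gaussian_PiM
    by (subst indep_vars_iff_distr_eq_PiM) (auto simp: restrict_def)
qed

text \<open>\<open>\<delta> \<bullet> z\<close> is a sum of independent centred normals with
  standard deviations \<open>\<bar>\<delta> $ i\<bar> * \<sigma>\<close>; the variances add up to
  \<open>(\<sigma> * norm \<delta>)\<close> squared.\<close>

lemma distributed_inner_isotropic_gaussian:
  assumes "\<delta> \<noteq> 0"
  shows "distributed (isotropic_gaussian \<sigma>) lborel (\<lambda>z. \<delta> \<bullet> z / (\<sigma> * norm \<delta>)) std_normal_density"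
proof -
  interpret prob_space "isotropic_gaussian \<sigma> :: (real ^ 'a) measure" by (rule prob_space_isotropic_gaussian)
  \<comment> \<open>Vanishing coordinates would contribute degenerate normals with standard
    deviation 0, so they are dropped from the sum.\<close>
  define I where "I = {i. \<delta> $ i \<noteq> 0}"
  have "I \<noteq> {}" using assms by (auto simp: I_def vec_eq_iff)
  moreover have "indep_vars (\<lambda>_. borel) (\<lambda>i z. \<delta> $ i * z $ i) I"
    using indep_vars_subset[OF indep_vars_compose2[OF indep_vars_isotropic_gaussian, of "\<lambda>i. (*) (\<delta> $ i)" "\<lambda>_. borel"]]
    by simp
  moreover have "distributed (isotropic_gaussian \<sigma>) lborel (\<lambda>z. \<delta> $ i * z $ i) (normal_density 0 (\<bar>\<delta> $ i\<bar> * \<sigma>))"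
    if "i \<in> I" for i
    using normal_density_affine[OF distributed_isotropic_gaussian_component \<sigma>, of "\<delta> $ i" 0 i] that
    by (simp add: I_def)
  ultimately have "distributed (isotropic_gaussian \<sigma>) lborel (\<lambda>z. \<Sum>i\<in>I. \<delta> $ i * z $ i)
      (normal_density (\<Sum>i\<in>I. 0) (sqrt (\<Sum>i\<in>I. (\<bar>\<delta> $ i\<bar> * \<sigma>)\<^sup>2)))"
    using \<sigma> by (intro sum_indep_normal) (auto simp: I_def)
  moreover have "(\<Sum>i\<in>I. \<delta> $ i * z $ i) = \<delta> \<bullet> z" for z
    unfolding inner_vec_def I_def by (auto intro: sum.mono_neutral_left)
  moreover have "(\<Sum>i\<in>I. (\<bar>\<delta> $ i\<bar> * \<sigma>)\<^sup>2) = (\<sigma> * norm \<delta>)\<^sup>2"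
  proof -
    have "(\<Sum>i\<in>I. (\<bar>\<delta> $ i\<bar> * \<sigma>)\<^sup>2) = (\<Sum>i\<in>UNIV. (\<bar>\<delta> $ i\<bar> * \<sigma>)\<^sup>2)"
      unfolding I_def by (auto intro: sum.mono_neutral_left)
    also have "\<dots> = (\<sigma> * norm \<delta>)\<^sup>2"
      unfolding power_mult_distrib power2_norm_eq_inner inner_vec_def
      by (simp add: sum_distrib_left power2_eq_square mult_ac)
    finally show ?thesis .
  qed
  ultimately have "distributed (isotropic_gaussian \<sigma>) lborel (\<lambda>z. \<delta> \<bullet> z) (normal_density 0 (\<sigma> * norm \<delta>))"
    using \<sigma> by simp
  then show ?thesis
    using \<sigma> assms by (subst (asm) normal_standard_normal_convert) auto
qed

section \<open>Half-spaces and translations under the isotropic Gaussian\<close>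

lemma measure_halfspace_isotropic_gaussian:
  assumes "\<delta> \<noteq> 0"
  shows "measure (isotropic_gaussian \<sigma>) {z. \<delta> \<bullet> z / (\<sigma> * norm \<delta>) \<le> a} = std_cdf a"
proof -
  have "std_normal_distribution = distr (isotropic_gaussian \<sigma>) lborel (\<lambda>z. \<delta> \<bullet> z / (\<sigma> * norm \<delta>))"
    using distributed_inner_isotropic_gaussian[OF assms] by (simp add: distributed_def)
  then have "std_cdf a = measure (distr (isotropic_gaussian \<sigma>) lborel (\<lambda>z. \<delta> \<bullet> z / (\<sigma> * norm \<delta>))) {..a}"
    by (simp add: cdf_def)
  also have "\<dots> = measure (isotropic_gaussian \<sigma>) {z. \<delta> \<bullet> z / (\<sigma> * norm \<delta>) \<le> a}"
    by (subst measure_distr) (auto intro!: arg_cong2[where f = measure])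
  finally show ?thesis ..
qed

text \<open>Expanding the square in each exponent leaves a likelihood ratio that depends on
  \<open>z\<close> only through \<open>\<delta> \<bullet> z\<close> and increases with it. This is
  what makes half-spaces orthogonal to \<open>\<delta>\<close> extremal.\<close>

lemma isotropic_density_shift:
  "isotropic_density \<sigma> (z - \<delta>) = exp ((\<delta> \<bullet> z - (norm \<delta>)\<^sup>2 / 2) / \<sigma>\<^sup>2) * isotropic_density \<sigma> z"
proof -
  have "normal_density 0 \<sigma> (z $ i - \<delta> $ i)
      = exp ((\<delta> $ i * z $ i - (\<delta> $ i)\<^sup>2 / 2) / \<sigma>\<^sup>2) * normal_density 0 \<sigma> (z $ i)" for i
    using \<sigma> by (simp add: normal_density_def field_simps power2_eq_square flip: exp_add)
  then have "isotropic_density \<sigma> (z - \<delta>)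
      = exp (\<Sum>i\<in>UNIV. (\<delta> $ i * z $ i - (\<delta> $ i)\<^sup>2 / 2) / \<sigma>\<^sup>2) * isotropic_density \<sigma> z"
    by (simp add: isotropic_density_def prod.distrib exp_sum)
  also have "(\<Sum>i\<in>UNIV. (\<delta> $ i * z $ i - (\<delta> $ i)\<^sup>2 / 2) / \<sigma>\<^sup>2) = (\<delta> \<bullet> z - (norm \<delta>)\<^sup>2 / 2) / \<sigma>\<^sup>2"
    unfolding power2_norm_eq_inner inner_vec_def
    by (simp add: sum_subtractf power2_eq_square flip: sum_divide_distrib)
  finally show ?thesis .
qed

lemma integrable_isotropic_density: "integrable lborel (isotropic_density \<sigma> :: real ^ 'd \<Rightarrow> real)"
proof -
  have "emeasure (isotropic_gaussian \<sigma> :: (real ^ 'd) measure) UNIV = 1"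
    using prob_space.emeasure_space_1[OF prob_space_isotropic_gaussian] by simp
  then have "(\<integral>\<^sup>+z. ennreal (isotropic_density \<sigma> (z :: real ^ 'd)) \<partial>lborel) = 1"
    by (simp add: isotropic_gaussian_eq emeasure_density)
  then show ?thesis by (intro integrableI_nonneg) auto
qed

text \<open>By translation invariance of Lebesgue measure the shift moves from the set to the
  density, so that original and shifted probabilities become integrals of two densities over the
  same set, as \<open>neyman_pearson\<close> expects.\<close>

lemma measure_isotropic_gaussian_shift:
  assumes [measurable]: "S \<in> sets borel"
  shows "measure (isotropic_gaussian \<sigma>) {z. z + \<delta> \<in> S} = (LINT z:S|lborel. isotropic_density \<sigma> (z - \<delta>))"
proof -
  have "measure (isotropic_gaussian \<sigma>) {z. z + \<delta> \<in> S} = (LINT z|isotropic_gaussian \<sigma>. indicator S (z + \<delta>))"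
    using Bochner_Integration.integral_indicator[of "isotropic_gaussian \<sigma>" "{z. z + \<delta> \<in> S}"]
    by (simp add: indicator_def[abs_def])
  also have "\<dots> = (LINT z|lborel. isotropic_density \<sigma> z * indicator S (z + \<delta>))"
    unfolding isotropic_gaussian_eq by (subst integral_density) auto
  also have "\<dots> = (LINT z|distr lborel borel ((+) \<delta>). isotropic_density \<sigma> (z - \<delta>) * indicator S z)"
    by (subst integral_distr) (auto simp: add.commute)
  finally show ?thesis
    by (simp add: lborel_distr_plus set_lebesgue_integral_def mult.commute)
qed

lemma integrable_isotropic_density_shift:
  "integrable lborel (\<lambda>z :: real ^ 'd. isotropic_density \<sigma> (z - \<delta>))"
proof -
  have "integrable (distr lborel borel ((+) \<delta>)) (\<lambda>z :: real ^ 'd. isotropic_density \<sigma> (z - \<delta>))"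
    using integrable_isotropic_density by (subst integrable_distr_eq) auto
  then show ?thesis by (simp add: lborel_distr_plus)
qed

text \<open>Adding \<open>\<delta>\<close> changes the normalised coordinate by
  \<open>\<delta> \<bullet> \<delta> / (\<sigma> * norm \<delta>)\<close>, which is
  \<open>norm \<delta> / \<sigma>\<close>; the orientation of the half-space decides the
  sign.\<close>

lemma measure_shifted_halfspace:
  assumes "\<delta> \<noteq> 0"
  shows "measure (isotropic_gaussian \<sigma>) {z. z + \<delta> \<in> {z. \<delta> \<bullet> z / (\<sigma> * norm \<delta>) \<le> a}}
      = std_cdf (a - norm \<delta> / \<sigma>)"
    and "measure (isotropic_gaussian \<sigma>) {z. z + \<delta> \<in> {z. - \<delta> \<bullet> z / (\<sigma> * norm \<delta>) \<le> a}}
      = std_cdf (a + norm \<delta> / \<sigma>)"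
proof -
  have *: "\<delta> \<bullet> \<delta> / (\<sigma> * norm \<delta>) = norm \<delta> / \<sigma>"
    using assms by (simp add: power2_eq_square flip: power2_norm_eq_inner)
  show "measure (isotropic_gaussian \<sigma>) {z. z + \<delta> \<in> {z. \<delta> \<bullet> z / (\<sigma> * norm \<delta>) \<le> a}}
      = std_cdf (a - norm \<delta> / \<sigma>)"
    using measure_halfspace_isotropic_gaussian[OF assms, of "a - norm \<delta> / \<sigma>"]
    by (simp add: inner_right_distrib add_divide_distrib * algebra_simps)
  show "measure (isotropic_gaussian \<sigma>) {z. z + \<delta> \<in> {z. - \<delta> \<bullet> z / (\<sigma> * norm \<delta>) \<le> a}}
      = std_cdf (a + norm \<delta> / \<sigma>)"
    using measure_halfspace_isotropic_gaussian[of "- \<delta>" "a + norm \<delta> / \<sigma>"] assms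
    by (simp add: inner_right_distrib add_divide_distrib * diff_le_eq minus_divide_left[symmetric])
qed

text \<open>The upper bound compares \<open>E\<close> with the half-space \<open>H1\<close> where
  \<open>\<delta> \<bullet> z\<close> is large, which gains most from the shift; the lower bound
  uses the opposite one, \<open>H2\<close>, which loses most.\<close>

lemma isotropic_gaussian_shift_bounds:
  fixes \<delta> :: "real ^ 'd"
  assumes E: "E \<in> sets borel"
  shows "measure (isotropic_gaussian \<sigma>) E \<le> std_cdf a \<Longrightarrow>
      measure (isotropic_gaussian \<sigma>) {z. z + \<delta> \<in> E} \<le> std_cdf (a + norm \<delta> / \<sigma>)" (is "?U \<Longrightarrow> ?U'")
    and "std_cdf a \<le> measure (isotropic_gaussian \<sigma>) E \<Longrightarrow>
      std_cdf (a - norm \<delta> / \<sigma>) \<le> measure (isotropic_gaussian \<sigma>) {z. z + \<delta> \<in> E}" (is "?L \<Longrightarrow> ?L'")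
proof -
  note E [measurable]
  define H1 H2 where "H1 = {z. - \<delta> \<bullet> z / (\<sigma> * norm \<delta>) \<le> a}" and "H2 = {z. \<delta> \<bullet> z / (\<sigma> * norm \<delta>) \<le> a}"
  have [measurable]: "H1 \<in> sets borel" "H2 \<in> sets borel" unfolding H1_def H2_def by measurable
  have P: "measure (isotropic_gaussian \<sigma>) S = (LINT z:S|lborel. isotropic_density \<sigma> z)"
    if "S \<in> sets borel" for S :: "(real ^ 'd) set"
    using measure_isotropic_gaussian_shift[OF that, of 0] by simp
  \<comment> \<open>\<open>c t\<close> is the likelihood ratio on the hyperplane where the
    normalised coordinate equals \<open>t\<close>.\<close>
  define c where "c t = exp ((t * (\<sigma> * norm \<delta>) - (norm \<delta>)\<^sup>2 / 2) / \<sigma>\<^sup>2)" for t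
  have le: "c t * isotropic_density \<sigma> z \<le> isotropic_density \<sigma> (z - \<delta>)" if "t \<le> \<delta> \<bullet> z / (\<sigma> * norm \<delta>)" "\<delta> \<noteq> 0" for t z
    unfolding isotropic_density_shift c_def using that \<sigma>
    by (intro mult_right_mono) (auto simp: divide_right_mono field_simps)
  have ge: "isotropic_density \<sigma> (z - \<delta>) \<le> c t * isotropic_density \<sigma> z" if "\<delta> \<bullet> z / (\<sigma> * norm \<delta>) \<le> t" "\<delta> \<noteq> 0" for t z
    unfolding isotropic_density_shift c_def using that \<sigma>
    by (intro mult_right_mono) (auto simp: divide_right_mono field_simps)
  have c0: "0 \<le> c t" for t by (simp add: c_def)
  show ?U' if ?U
  \<comment> \<open>Without a shift there is no direction for a half-space, and the claim is the
    hypothesis itself.\<close>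
  proof (cases "\<delta> = 0")
    case False
    \<comment> \<open>\<open>H1\<close> is bounded by the hyperplane at normalised coordinate
      \<open>- a\<close>, hence the constant \<open>c (- a)\<close>.\<close>
    have "(LINT z:E|lborel. isotropic_density \<sigma> (z - \<delta>)) \<le> (LINT z:H1|lborel. isotropic_density \<sigma> (z - \<delta>))"
      by (rule neyman_pearson[OF integrable_isotropic_density integrable_isotropic_density_shift, where c = "c (- a)"])
         (use that measure_halfspace_isotropic_gaussian[of "- \<delta>" a] False c0 le ge in
           \<open>auto simp: H1_def simp flip: P\<close>)
    then show ?thesis
      using measure_shifted_halfspace(2)[OF False, of a, folded H1_def]
      by (simp add: measure_isotropic_gaussian_shift)
  qed (use that in simp)
  show ?L' if ?L
  proof (cases "\<delta> = 0")
    case False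
    have "(LINT z:H2|lborel. isotropic_density \<sigma> (z - \<delta>)) \<le> (LINT z:E|lborel. isotropic_density \<sigma> (z - \<delta>))"
      by (rule neyman_pearson[OF integrable_isotropic_density integrable_isotropic_density_shift, where c = "c a"])
         (use that measure_halfspace_isotropic_gaussian[of "\<delta>" a] False c0 le ge in
           \<open>auto simp: H2_def simp flip: P\<close>)
    then show ?thesis
      using measure_shifted_halfspace(1)[OF False, of a, folded H2_def]
      by (simp add: measure_isotropic_gaussian_shift)
  qed (use that in simp)
qed

end


text \<open>This turns a sum over several labels into the probability of one event, so that the
  shift bound is applied once to the union and not label by label.\<close>

lemma sum_label_prob:
  fixes f :: "real ^ 'd \<Rightarrow> nat"
  assumes "0 < \<sigma>" and f: "f \<in> borel \<rightarrow>\<^sub>M count_space UNIV" and "finite I"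
  shows "(\<Sum>i\<in>I. label_prob \<sigma> f z i) = measure (isotropic_gaussian \<sigma>) {e. f (z + e) \<in> I}"
proof -
  interpret prob_space "isotropic_gaussian \<sigma> :: (real ^ 'd) measure"
    using \<open>0 < \<sigma>\<close> by (rule prob_space_isotropic_gaussian)
  note f [measurable]
  have "(\<Sum>i\<in>I. label_prob \<sigma> f z i) = measure (isotropic_gaussian \<sigma>) (\<Union>i\<in>I. {e. f (z + e) = i})"
    unfolding label_prob_def using \<open>finite I\<close>
    by (intro finite_measure_finite_Union[symmetric]) (auto simp: disjoint_family_on_def)
  also have "(\<Union>i\<in>I. {e. f (z + e) = i}) = {e. f (z + e) \<in> I}" by auto
  finally show ?thesis .
qed

subsection \<open>Selection of labels and the radius equation\<close>

text \<open>Let \<open>h\<close> fix the common elements and match \<open>B - T\<close> with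
  \<open>T - B\<close>, which have equal size. Anything outside the top set \<open>B\<close> has a
  value no larger than anything inside.\<close>

lemma is_top_k_dominates:
  assumes B: "is_top_k k A p B" and T: "T \<subseteq> A" "finite T" "card T = k"
  obtains h where "bij_betw h B T" "\<And>i. i \<in> B \<Longrightarrow> p (h i) \<le> p i"
proof -
  have fin: "finite B" "card B = card T" using B T by (auto simp: is_top_k_def)
  then have "card (B - T) = card (T - B)"
    using T card_Int_Diff[of B T] card_Int_Diff[of T B] by (simp add: Int_commute)
  then obtain \<phi> where \<phi>: "bij_betw \<phi> (B - T) (T - B)"
    using finite_same_card_bij[of "B - T" "T - B"] fin T by auto
  define h where "h i = (if i \<in> T then i else \<phi> i)" for i
  have "bij_betw h (B \<inter> T) (B \<inter> T)"
    by (rule bij_betw_cong[THEN iffD1, OF _ bij_betw_id]) (simp add: h_def)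
  moreover have "bij_betw h (B - T) (T - B)"
    by (rule bij_betw_cong[THEN iffD1, OF _ \<phi>]) (simp add: h_def)
  ultimately have "bij_betw h ((B \<inter> T) \<union> (B - T)) ((B \<inter> T) \<union> (T - B))"
    by (rule bij_betw_combine) auto
  moreover have "(B \<inter> T) \<union> (B - T) = B" "(B \<inter> T) \<union> (T - B) = T" by auto
  ultimately have "bij_betw h B T" by simp
  moreover have "p (h i) \<le> p i" if "i \<in> B" for i
  proof (cases "i \<in> T")
    case False
    then have "\<phi> i \<in> T - B" using \<phi> that by (auto simp: bij_betw_def)
    then show ?thesis using B T that False by (auto simp: is_top_k_def h_def)
  qed (simp add: h_def)
  ultimately show ?thesis by (rule that)
qed

section \<open>The two sides of the radius equation as functions of the radius\<close>

lemma std_normal_cdf_infty [simp]: "std_normal_cdf \<infinity> = 1" "std_normal_cdf (- \<infinity>) = 0"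
proof -
  show "std_normal_cdf \<infinity> = 1" by (metis infinity_ereal_def std_normal_cdf.simps(2))
  show "std_normal_cdf (- \<infinity>) = 0" by (metis MInfty_eq_minfinity std_normal_cdf.simps(3))
qed

lemma std_normal_cdf_nonneg: "0 \<le> std_normal_cdf a"
  by (cases a) (simp_all add: std_normal.cdf_nonneg)

lemma std_normal_cdf_le_1: "std_normal_cdf a \<le> 1"
  by (cases a) (simp_all add: std_normal.cdf_bounded_prob)

lemma continuous_on_std_cdf [continuous_intros]:
  assumes "continuous_on S h"
  shows "continuous_on S (\<lambda>x. std_cdf (h x))"
proof (rule continuous_on_compose2[OF _ assms])
  show "continuous_on UNIV std_cdf"
    using isCont_std_cdf by (intro continuous_at_imp_continuous_on) blast
qed simp

text \<open>An infinite quantile absorbs every finite shift, so outside the open unit interval the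
  shifted values are constant. Later proofs split along these three cases.\<close>

lemma std_normal_cdf_quantile_cases:
  fixes s :: real
  obtains "s \<le> 0" "\<And>r. std_normal_cdf (std_normal_quantile s + ereal r) = 0"
      "\<And>r. std_normal_cdf (std_normal_quantile s - ereal r) = 0"
  | "1 \<le> s" "\<And>r. std_normal_cdf (std_normal_quantile s + ereal r) = 1"
      "\<And>r. std_normal_cdf (std_normal_quantile s - ereal r) = 1"
  | a where "0 < s" "s < 1" "std_cdf a = s"
      "\<And>r. std_normal_cdf (std_normal_quantile s + ereal r) = std_cdf (a + r)"
      "\<And>r. std_normal_cdf (std_normal_quantile s - ereal r) = std_cdf (a - r)"
proof -
  consider "s \<le> 0" | "1 \<le> s" | "0 < s" "s < 1" by linarith
  then show ?thesis
  proof cases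
    case 1
    then have "std_normal_quantile s = - \<infinity>" by (simp add: std_normal_quantile_def)
    with 1 show ?thesis by (intro that(1)) auto
  next
    case 2
    then have "std_normal_quantile s = \<infinity>" by (simp add: std_normal_quantile_def)
    with 2 show ?thesis by (intro that(2)) auto
  next
    case 3
    then obtain a where "std_normal_quantile s = ereal a" "std_cdf a = s" by (rule std_cdf_quantile)
    with 3 show ?thesis by (intro that(3)[of a]) auto
  qed
qed

text \<open>For \<open>1 \<le> s\<close> the function is constantly 1, so monotonicity is not strict
  in general and the limit at \<open>at_bot\<close> is claimed only for
  \<open>s < 1\<close>.\<close>

lemma std_normal_cdf_quantile_add_properties:
  fixes \<sigma> s :: real
  assumes "0 < \<sigma>" "0 < s"
  defines "F \<equiv> (\<lambda>R. std_normal_cdf (std_normal_quantile s + ereal (R / \<sigma>)))"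
  shows "continuous_on UNIV F" "mono F" "(F \<longlongrightarrow> 1) at_top" "0 < F R"
    and "s < 1 \<Longrightarrow> (F \<longlongrightarrow> 0) at_bot"
proof -
  have "continuous_on UNIV F \<and> mono F \<and> (F \<longlongrightarrow> 1) at_top \<and> 0 < F R \<and> (s < 1 \<longrightarrow> (F \<longlongrightarrow> 0) at_bot)"
  proof (cases rule: std_normal_cdf_quantile_cases[of s])
    case 1
    then show ?thesis using assms by simp
  next
    case 2
    then show ?thesis by (simp add: F_def mono_def)
  next
    case (3 a)
    then have F: "F = (\<lambda>R. std_cdf (a + R * (1 / \<sigma>)))" by (simp add: F_def)
    have "filterlim (\<lambda>R. a + R * (1 / \<sigma>)) at_top at_top" "filterlim (\<lambda>R. a + R * (1 / \<sigma>)) at_bot at_bot"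
      using \<open>0 < \<sigma>\<close> by real_asymp+
    then have "(F \<longlongrightarrow> 1) at_top" "(F \<longlongrightarrow> 0) at_bot" unfolding F
      using filterlim_compose[OF std_normal.cdf_lim_at_top_prob]
        filterlim_compose[OF std_normal.cdf_lim_at_bot] by blast+
    moreover have "continuous_on UNIV F" unfolding F by (intro continuous_intros)
    ultimately show ?thesis
      using \<open>0 < \<sigma>\<close> unfolding F by (simp add: mono_def std_cdf_pos divide_right_mono)
  qed
  then show "continuous_on UNIV F" "mono F" "(F \<longlongrightarrow> 1) at_top" "0 < F R"
    and "s < 1 \<Longrightarrow> (F \<longlongrightarrow> 0) at_bot" by blast+
qed

text \<open>The quantile is finite here, so \<open>G\<close> inherits strictness from
  \<open>std_cdf\<close>; this strictness makes the zero of the gap unique.\<close>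

lemma std_normal_cdf_quantile_diff_properties:
  fixes \<sigma> p :: real
  assumes "0 < \<sigma>" "0 < p" "p < 1"
  defines "G \<equiv> (\<lambda>R. std_normal_cdf (std_normal_quantile p - ereal (R / \<sigma>)))"
  shows "continuous_on UNIV G" "strict_antimono_on UNIV G" "(G \<longlongrightarrow> 0) at_top" "(G \<longlongrightarrow> 1) at_bot"
    and "G R < 1"
proof -
  have "continuous_on UNIV G \<and> strict_antimono_on UNIV G \<and> (G \<longlongrightarrow> 0) at_top \<and> (G \<longlongrightarrow> 1) at_bot \<and> G R < 1"
  proof (cases rule: std_normal_cdf_quantile_cases[of p])
    case (3 a)
    then have G: "G = (\<lambda>R. std_cdf (a + R * (- 1 / \<sigma>)))" by (simp add: G_def)
    have "filterlim (\<lambda>R. a + R * (- 1 / \<sigma>)) at_bot at_top" "filterlim (\<lambda>R. a + R * (- 1 / \<sigma>)) at_top at_bot"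
      using \<open>0 < \<sigma>\<close> by real_asymp+
    then have "(G \<longlongrightarrow> 0) at_top" "(G \<longlongrightarrow> 1) at_bot" unfolding G
      using filterlim_compose[OF std_normal.cdf_lim_at_bot]
        filterlim_compose[OF std_normal.cdf_lim_at_top_prob] by blast+
    moreover have "continuous_on UNIV G" unfolding G by (intro continuous_intros)
    ultimately show ?thesis
      using \<open>0 < \<sigma>\<close> unfolding G by (simp add: monotone_on_def std_cdf_less_1 divide_strict_right_mono)
  qed (use assms in auto)
  then show "continuous_on UNIV G" "strict_antimono_on UNIV G" "(G \<longlongrightarrow> 0) at_top" "(G \<longlongrightarrow> 1) at_bot"
    and "G R < 1" by blast+
qed

lemma continuous_on_Min_image:
  fixes F :: "'i \<Rightarrow> 'a::topological_space \<Rightarrow> real"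
  assumes "finite I" "I \<noteq> {}" "\<And>i. i \<in> I \<Longrightarrow> continuous_on S (F i)"
  shows "continuous_on S (\<lambda>x. Min ((\<lambda>i. F i x) ` I))"
  using assms
proof (induction rule: finite_ne_induct)
  case (insert i I)
  then show ?case by (auto intro!: continuous_on_min)
qed simp

text \<open>The gap is a strictly decreasing term minus a nondecreasing minimum. Its zero comes from
  the intermediate value theorem, with a negative value far to the right and a positive one far to
  the left.\<close>

lemma radius_gap_properties:
  fixes \<sigma> p_low :: real
  assumes "0 < \<sigma>" "1 \<le> k" "0 < p_low" "p_low < 1"
    and nonneg: "\<And>j. j \<in> {1..k} \<Longrightarrow> 0 \<le> p_up (b j)"
    and "0 < p_up (b 1)" "k = 1 \<longrightarrow> p_up (b 1) < 1"
  shows "strict_antimono_on UNIV (radius_gap \<sigma> k p_low p_up b)"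
    and "\<exists>R. radius_gap \<sigma> k p_low p_up b R = 0"
proof -
  define s where "s t = (\<Sum>j=1..t. p_up (b j))" for t
  have s: "0 < s t" if "t \<in> {1..k}" for t
  proof -
    have "p_up (b 1) \<le> s t" unfolding s_def
      using that nonneg by (intro member_le_sum) auto
    then show ?thesis using \<open>0 < p_up (b 1)\<close> by linarith
  qed
  define F where "F t R = std_normal_cdf (std_normal_quantile (s t) + ereal (R / \<sigma>))" for t R
  define G where "G R = std_normal_cdf (std_normal_quantile p_low - ereal (R / \<sigma>))" for R
  define m where "m R = Min ((\<lambda>t. F t R / real t) ` {1..k})" for R
  have gap: "radius_gap \<sigma> k p_low p_up b = (\<lambda>R. G R - m R)"
    by (simp add: fun_eq_iff radius_gap_def m_def F_def G_def s_def)
  have F_eq: "F t = (\<lambda>R. std_normal_cdf (std_normal_quantile (s t) + ereal (R / \<sigma>)))" for t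
    by (simp add: fun_eq_iff F_def)
  note F = std_normal_cdf_quantile_add_properties[OF \<open>0 < \<sigma>\<close> s, folded F_eq]
  note G = std_normal_cdf_quantile_diff_properties[OF \<open>0 < \<sigma>\<close> \<open>0 < p_low\<close> \<open>p_low < 1\<close>, folded G_def[abs_def]]
  have m_le: "m R \<le> F t R / real t" if "t \<in> {1..k}" for t R
    unfolding m_def using that by (intro Min_le) auto
  have m_less: "x < m R" if "\<And>t. t \<in> {1..k} \<Longrightarrow> x < F t R / real t" for x R
    unfolding m_def using that \<open>1 \<le> k\<close> by (subst Min_gr_iff) auto
  have m_mono: "m x \<le> m y" if "x \<le> y" for x y
  proof -
    have "m x \<le> F t y / real t" if t: "t \<in> {1..k}" for t
      using m_le[OF t, of x] monoD[OF F(2)[OF t] \<open>x \<le> y\<close>] by (meson divide_right_mono of_nat_0_le_iff order_trans)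
    then show ?thesis unfolding m_def[of y] using \<open>1 \<le> k\<close> by (subst Min_ge_iff) auto
  qed
  show "strict_antimono_on UNIV (radius_gap \<sigma> k p_low p_up b)"
    unfolding gap
  proof (rule monotone_onI)
    fix x y :: real assume "x < y"
    then show "G y - m y < G x - m x"
      using m_mono[of x y] monotone_onD[OF G(2), of x y] by simp
  qed
  have "continuous_on UNIV (\<lambda>R. G R - m R)"
    unfolding m_def using \<open>1 \<le> k\<close> F(1) G(1)
    by (intro continuous_intros continuous_on_Min_image) auto
  \<comment> \<open>Once every \<open>F t R\<close> exceeds 1/2, each quotient by
    \<open>t \<le> k\<close> exceeds \<open>1 / (2 * real k)\<close>.\<close>
  have "eventually (\<lambda>R. G R < 1 / (2 * real k)) at_top"
    using G(3) by (rule order_tendstoD) (use \<open>1 \<le> k\<close> in simp)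
  moreover have "eventually (\<lambda>R. \<forall>t\<in>{1..k}. 1 / 2 < F t R) at_top"
    by (intro eventually_ball_finite ballI order_tendstoD(1)[OF F(3)]) auto
  ultimately have "eventually (\<lambda>R. G R - m R < 0) at_top"
  proof eventually_elim
    case (elim R)
    have "1 / (2 * real k) < F t R / real t" if "t \<in> {1..k}" for t
    proof -
      have "1 / (2 * real k) \<le> (1 / 2) / real t" using that by (simp add: field_simps)
      also have "\<dots> < F t R / real t" using elim(2) that by (intro divide_strict_right_mono) auto
      finally show ?thesis .
    qed
    then show ?case using m_less elim(1) by force
  qed
  then obtain y where y: "G y - m y < 0" by (auto dest: eventually_happens)
  \<comment> \<open>For \<open>k \<ge> 2\<close> the term with \<open>t = k\<close> is at most 1/2
    for every \<open>R\<close>. For \<open>k = 1\<close> the only term tends to 0, by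
    \<open>p_up (b 1) < 1\<close>.\<close>
  have "eventually (\<lambda>R. m R \<le> 1 / 2) at_bot"
  proof (cases "k = 1")
    case True
    then have "s 1 < 1" using assms by (simp add: s_def)
    then have "eventually (\<lambda>R. F 1 R < 1 / 2) at_bot"
      using \<open>1 \<le> k\<close> by (intro order_tendstoD(2)[OF F(5)]) auto
    then show ?thesis
    proof eventually_elim
      case (elim R)
      then show ?case using m_le[of 1 R] \<open>1 \<le> k\<close> by simp
    qed
  next
    case False
    have "m R \<le> 1 / 2" for R
    proof -
      have "m R \<le> F k R / real k" using \<open>1 \<le> k\<close> by (intro m_le) auto
      also have "\<dots> \<le> 1 / 2"
        using \<open>1 \<le> k\<close> False std_normal_cdf_le_1 unfolding F_def by (intro frac_le) auto
      finally show ?thesis .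
    qed
    then show ?thesis by simp
  qed
  moreover have "eventually (\<lambda>R. 1 / 2 < G R) at_bot"
    using G(4) by (rule order_tendstoD) simp
  ultimately have "eventually (\<lambda>R. 0 < G R - m R) at_bot"
    by eventually_elim simp
  moreover have "eventually (\<lambda>R. R \<le> y) at_bot" by (rule eventually_le_at_bot)
  ultimately have "eventually (\<lambda>R. 0 < G R - m R \<and> R \<le> y) at_bot" by (rule eventually_conj)
  then obtain x where "0 < G x - m x" "x \<le> y" by (auto dest: eventually_happens)
  then show "\<exists>R. radius_gap \<sigma> k p_low p_up b R = 0"
    using IVT2'[of "\<lambda>R. G R - m R" y 0 x] y continuous_on_subset[OF \<open>continuous_on UNIV (\<lambda>R. G R - m R)\<close>]
    unfolding gap by auto
qed

text \<open>In the degenerate cases the gap either vanishes identically or has no zero.\<close>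

lemma unique_radius_nondegenerate:
  fixes \<sigma> p_low :: real
  assumes "0 < \<sigma>" "1 \<le> k" "0 \<le> p_low" "p_low \<le> 1"
    and nonneg: "\<And>j. j \<in> {1..k} \<Longrightarrow> 0 \<le> p_up (b j)"
    and zero: "radius_gap \<sigma> k p_low p_up b R = 0"
    and uniq: "\<forall>R'. radius_gap \<sigma> k p_low p_up b R' = 0 \<longrightarrow> R' = R"
  shows "0 < p_low \<and> p_low < 1 \<and> 0 < p_up (b 1) \<and> (k = 1 \<longrightarrow> p_up (b 1) < 1)"
proof -
  define s where "s t = (\<Sum>j=1..t. p_up (b j))" for t
  define F where "F t R = std_normal_cdf (std_normal_quantile (s t) + ereal (R / \<sigma>))" for t R
  define G where "G R = std_normal_cdf (std_normal_quantile p_low - ereal (R / \<sigma>))" for R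
  define m where "m R = Min ((\<lambda>t. F t R / real t) ` {1..k})" for R
  have gap: "radius_gap \<sigma> k p_low p_up b = (\<lambda>R. G R - m R)"
    by (simp add: fun_eq_iff radius_gap_def m_def F_def G_def s_def)
  have s1: "s 1 = p_up (b 1)" by (simp add: s_def)
  have m_le: "m R \<le> F t R / real t" if "t \<in> {1..k}" for t R
    unfolding m_def using that by (intro Min_le) auto
  have G_1: "G R = 1" if "p_low = 1" for R
    using that by (cases rule: std_normal_cdf_quantile_cases[of p_low]) (auto simp: G_def)
  have G_less: "G R < 1" if "p_low \<noteq> 1" for R
    using that assms(4) by (cases rule: std_normal_cdf_quantile_cases[of p_low]) (auto simp: G_def std_cdf_less_1)
  have G_0: "G R = 0" if "p_low = 0" for R
    using that by (cases rule: std_normal_cdf_quantile_cases[of p_low]) (auto simp: G_def)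
  have G_pos: "0 < G R" if "p_low \<noteq> 0" for R
    using that assms(3) by (cases rule: std_normal_cdf_quantile_cases[of p_low]) (auto simp: G_def std_cdf_pos)
  \<comment> \<open>An identically vanishing gap would make \<open>R + 1\<close> a second
    zero.\<close>
  have not_constant: "\<not> (\<forall>R. G R = m R)"
  proof
    assume "\<forall>R. G R = m R"
    then have "R + 1 = R" using uniq[rule_format, of "R + 1"] unfolding gap by simp
    then show False by simp
  qed
  have "G R = m R" using zero unfolding gap by simp
  \<comment> \<open>Otherwise \<open>m\<close> is identically 0, while \<open>G\<close> is
    identically 0 or positive everywhere: the gap has every real as a zero, or none.\<close>
  have p_up: "0 < p_up (b 1)"
  proof (rule ccontr)
    assume "\<not> 0 < p_up (b 1)"
    then have "F 1 R = 0" for R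
      using s1 by (cases rule: std_normal_cdf_quantile_cases[of "s 1"]) (auto simp: F_def)
    then have "m R = 0" for R
      using m_le[of 1 R] \<open>1 \<le> k\<close> std_normal_cdf_nonneg unfolding m_def
      by (intro antisym) (auto simp: F_def)
    then show False
      using not_constant \<open>G R = m R\<close> G_0 G_pos[of R] by (cases "p_low = 0") auto
  qed
  \<comment> \<open>Otherwise \<open>m\<close> is identically 1, while \<open>G\<close> is
    identically 1 or below 1 everywhere.\<close>
  have k1: "p_up (b 1) < 1" if "k = 1"
  proof (rule ccontr)
    assume "\<not> p_up (b 1) < 1"
    then have "F 1 R = 1" for R
      using s1 by (cases rule: std_normal_cdf_quantile_cases[of "s 1"]) (auto simp: F_def)
    then have "m R = 1" for R using \<open>k = 1\<close> by (simp add: m_def)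
    then show False
      using not_constant \<open>G R = m R\<close> G_1 G_less[of R] by (cases "p_low = 1") auto
  qed
  have "p_low \<noteq> 0"
  proof
    assume "p_low = 0"
    have "0 < F t R" if "t \<in> {1..k}" for t
    proof -
      have "p_up (b 1) \<le> s t" unfolding s_def
        using that nonneg by (intro member_le_sum) auto
      then show ?thesis
        using std_normal_cdf_quantile_add_properties(4)[OF \<open>0 < \<sigma>\<close>] p_up unfolding F_def by simp
    qed
    then have "0 < m R" unfolding m_def using \<open>1 \<le> k\<close> by (subst Min_gr_iff) auto
    then show False using \<open>G R = m R\<close> G_0[OF \<open>p_low = 0\<close>] by simp
  qed
  \<comment> \<open>With \<open>G\<close> identically 1, a zero needs \<open>F k R \<ge> k\<close>,
    hence \<open>k = 1\<close>; but then \<open>p_up (b 1) < 1\<close> keeps \<open>F k R\<close>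
    below 1.\<close>
  moreover have "p_low \<noteq> 1"
  proof
    assume "p_low = 1"
    then have "1 \<le> F k R / real k"
      using m_le[of k R] \<open>1 \<le> k\<close> \<open>G R = m R\<close> G_1 by simp
    then have "real k \<le> F k R" using \<open>1 \<le> k\<close> by (simp add: field_simps)
    moreover have "F k R \<le> 1" unfolding F_def by (rule std_normal_cdf_le_1)
    ultimately have "k = 1" using \<open>1 \<le> k\<close> by linarith
    with k1 s1 p_up have "F k R < 1"
      by (cases rule: std_normal_cdf_quantile_cases[of "s 1"]) (auto simp: F_def std_cdf_less_1)
    with \<open>real k \<le> F k R\<close> \<open>k = 1\<close> show False by simp
  qed
  ultimately show ?thesis using assms(3,4) p_up k1 by auto
qed

text \<open>A single \<open>t\<close> whose upper bound, averaged over \<open>t\<close> labels, lies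
  below the lower bound for \<open>l\<close> already certifies \<open>l\<close>; the choice of
  \<open>t\<close> is left to the application.\<close>

lemma certified_top_k:
  fixes x \<delta> :: "real ^ 'd" and f :: "real ^ 'd \<Rightarrow> nat" and g :: "real ^ 'd \<Rightarrow> nat set"
  assumes \<sigma>: "0 < \<sigma>" and f: "f \<in> borel \<rightarrow>\<^sub>M count_space UNIV"
    and g: "is_smoothed_classifier \<sigma> c k f g"
    and l: "l \<in> {1..c}" and p_low: "0 < p_low" "p_low < 1" "p_low \<le> label_prob \<sigma> f x l"
    and p_up: "\<And>i. i \<in> {1..c} - {l} \<Longrightarrow> label_prob \<sigma> f x i \<le> p_up i"
    and b: "is_top_k_enum k ({1..c} - {l}) p_up b"
    and t: "t \<in> {1..k}" and pos: "0 < (\<Sum>j=1..t. p_up (b j))"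
    and less: "std_normal_cdf (std_normal_quantile (\<Sum>j=1..t. p_up (b j)) + ereal (norm \<delta> / \<sigma>)) / real t
      < std_normal_cdf (std_normal_quantile p_low - ereal (norm \<delta> / \<sigma>))"
  shows "l \<in> g (x + \<delta>)"
proof (rule ccontr)
  assume "l \<notin> g (x + \<delta>)"
  interpret prob_space "isotropic_gaussian \<sigma> :: (real ^ 'd) measure"
    using \<sigma> by (rule prob_space_isotropic_gaussian)
  note f [measurable]
  let ?s = "\<Sum>j=1..t. p_up (b j)"
  define T where "T = g (x + \<delta>)"
  have T: "is_top_k k {1..c} (label_prob \<sigma> f (x + \<delta>)) T"
    using g by (simp add: is_smoothed_classifier_def T_def)
  have "T \<subseteq> {1..c} - {l}" "finite T" "card T = k"
    using T \<open>l \<notin> g (x + \<delta>)\<close> by (auto simp: is_top_k_def T_def)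
  moreover have top: "is_top_k k ({1..c} - {l}) p_up (b ` {1..k})" and inj: "inj_on b {1..k}"
    using b by (auto simp: is_top_k_enum_def)
  ultimately obtain h where h: "bij_betw h (b ` {1..k}) T" "\<And>i. i \<in> b ` {1..k} \<Longrightarrow> p_up (h i) \<le> p_up i"
    using is_top_k_dominates[OF top] by blast
  \<comment> \<open>\<open>I\<close> consists of \<open>t\<close> predicted labels, matched by
    \<open>h\<close> with the first \<open>t\<close> values of \<open>b\<close>; its upper bounds
    therefore sum to at most \<open>?s\<close>.\<close>
  define I where "I = (\<lambda>j. h (b j)) ` {1..t}"
  have "inj_on (\<lambda>j. h (b j)) {1..k}"
    using comp_inj_on[OF inj bij_betw_imp_inj_on[OF h(1)]] by (simp add: comp_def)
  then have injI: "inj_on (\<lambda>j. h (b j)) {1..t}"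
    by (rule inj_on_subset) (use t in auto)
  have "I \<subseteq> T" using h(1) t by (auto simp: I_def bij_betw_def)
  have shift: "{e. f (x + \<delta> + e) \<in> J} = {e. e + \<delta> \<in> {e. f (x + e) \<in> J}}" for J
    by (simp add: add_ac)
  have E: "{e. f (x + e) \<in> J} \<in> sets borel" for J by measurable
  have "real t * label_prob \<sigma> f (x + \<delta>) l = (\<Sum>i\<in>I. label_prob \<sigma> f (x + \<delta>) l)"
    using card_image[OF injI] by (simp add: I_def)
  also have "\<dots> \<le> (\<Sum>i\<in>I. label_prob \<sigma> f (x + \<delta>) i)"
    using T \<open>I \<subseteq> T\<close> l \<open>l \<notin> g (x + \<delta>)\<close> by (intro sum_mono) (auto simp: is_top_k_def T_def)
  also have "\<dots> = measure (isotropic_gaussian \<sigma>) {e. f (x + \<delta> + e) \<in> I}"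
    using \<sigma> f by (rule sum_label_prob) (simp add: I_def)
  also have "\<dots> \<le> std_normal_cdf (std_normal_quantile ?s + ereal (norm \<delta> / \<sigma>))"
  \<comment> \<open>If \<open>1 \<le> ?s\<close>, the right side is 1 and bounds any probability;
    \<open>?s \<le> 0\<close> is excluded by \<open>pos\<close>.\<close>
  proof (cases rule: std_normal_cdf_quantile_cases[of ?s])
    case (3 a)
    have "measure (isotropic_gaussian \<sigma>) {e. f (x + e) \<in> I} = (\<Sum>i\<in>I. label_prob \<sigma> f x i)"
      using \<sigma> f by (rule sum_label_prob[symmetric]) (simp add: I_def)
    also have "\<dots> \<le> (\<Sum>i\<in>I. p_up i)"
      using \<open>I \<subseteq> T\<close> \<open>T \<subseteq> {1..c} - {l}\<close> by (intro sum_mono p_up) auto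
    also have "\<dots> = (\<Sum>j=1..t. p_up (h (b j)))"
      unfolding I_def by (subst sum.reindex[OF injI]) simp
    also have "\<dots> \<le> ?s" using t by (intro sum_mono h(2)) auto
    finally show ?thesis
      using isotropic_gaussian_shift_bounds(1)[OF \<sigma> E, of I a \<delta>] 3 unfolding shift by simp
  qed (use pos in auto)
  also have "\<dots> < real t * std_normal_cdf (std_normal_quantile p_low - ereal (norm \<delta> / \<sigma>))"
    using less t by (simp add: field_simps)
  also have "\<dots> \<le> real t * label_prob \<sigma> f (x + \<delta>) l"
  proof (cases rule: std_normal_cdf_quantile_cases[of p_low])
    case (3 a)
    then show ?thesis
      using isotropic_gaussian_shift_bounds(2)[OF \<sigma> E, of a "{l}" \<delta>] p_low shift[of "{l}"]
      by (intro mult_left_mono) (simp_all add: label_prob_def)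
  qed (use p_low in auto)
  finally show False by simp
qed

text \<open>The first conjunct gives conditions under which the radius equation has exactly one
  solution. The second certifies \<open>l\<close> whenever a unique solution exists; by
  \<open>unique_radius_nondegenerate\<close> its existence forces those same conditions. The
  functions \<open>g\<close> and \<open>b\<close> stand for arbitrary outcomes of tie
  breaking.\<close>

theorem theorem1:
  fixes x :: "real ^ 'd"
    and f :: "real ^ 'd \<Rightarrow> nat"
    and g :: "real ^ 'd \<Rightarrow> nat set"
    and \<sigma> p_low :: real
    and c k l :: nat
    and p_up :: "nat \<Rightarrow> real"
    and b :: "nat \<Rightarrow> nat"
  assumes "\<sigma> > 0"
    and "1 \<le> k" and "k < c"
    and "f \<in> borel \<rightarrow>\<^sub>M count_space UNIV"
    and "\<And>z. f z \<in> {1..c}"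
    and "is_smoothed_classifier \<sigma> c k f g"
    and "l \<in> {1..c}"
    and "p_low \<in> {0..1}"
    and "\<And>i. i \<in> {1..c} - {l} \<Longrightarrow> p_up i \<in> {0..1}"
    and "label_prob \<sigma> f x l \<ge> p_low"
    and "\<And>i. i \<in> {1..c} - {l} \<Longrightarrow> label_prob \<sigma> f x i \<le> p_up i"
    and "is_top_k_enum k ({1..c} - {l}) p_up b"
  shows "(0 < p_low \<and> p_low < 1 \<and> 0 < p_up (b 1) \<and> (k = 1 \<longrightarrow> p_up (b 1) < 1)
            \<longrightarrow> (\<exists>!R. radius_gap \<sigma> k p_low p_up b R = 0))
       \<and> (\<forall>R\<^sub>l. radius_gap \<sigma> k p_low p_up b R\<^sub>l = 0
                \<and> (\<forall>R. radius_gap \<sigma> k p_low p_up b R = 0 \<longrightarrow> R = R\<^sub>l)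
            \<longrightarrow> (\<forall>\<delta>. norm \<delta> < R\<^sub>l \<longrightarrow> l \<in> g (x + \<delta>)))"
proof -
  let ?gap = "radius_gap \<sigma> k p_low p_up b"
  let ?nd = "0 < p_low \<and> p_low < 1 \<and> 0 < p_up (b 1) \<and> (k = 1 \<longrightarrow> p_up (b 1) < 1)"
  have b_in: "b j \<in> {1..c} - {l}" if "j \<in> {1..k}" for j
    using assms(12) that unfolding is_top_k_enum_def is_top_k_def by blast
  then have nonneg: "0 \<le> p_up (b j)" if "j \<in> {1..k}" for j
    using assms(9) that by force
  have anti: "?gap R' < ?gap R" if ?nd "R < R'" for R R'
    using monotone_onD[OF radius_gap_properties(1)] assms(1,2) nonneg that by blast
  have "\<exists>!R. ?gap R = 0" if ?nd
  proof -
    obtain R where R: "?gap R = 0"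
      using radius_gap_properties(2) assms(1,2) nonneg \<open>?nd\<close> by blast
    show ?thesis
    proof (rule ex1I[of _ R])
      show "R' = R" if "?gap R' = 0" for R'
        using anti[OF \<open>?nd\<close>, of R R'] anti[OF \<open>?nd\<close>, of R' R] that R by (cases R R' rule: linorder_cases) auto
    qed (rule R)
  qed
  moreover have "l \<in> g (x + \<delta>)"
    if R: "?gap R = 0" "\<forall>R'. ?gap R' = 0 \<longrightarrow> R' = R" and "norm \<delta> < R" for R \<delta>
  proof -
    let ?r = "norm \<delta> / \<sigma>"
    have nd: ?nd
      by (rule unique_radius_nondegenerate[OF assms(1,2) _ _ nonneg R]) (use assms(8) in auto)
    let ?F = "\<lambda>t. std_normal_cdf (std_normal_quantile (\<Sum>j=1..t. p_up (b j)) + ereal ?r) / real t"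
    have "0 < ?gap (norm \<delta>)" using anti[OF nd \<open>norm \<delta> < R\<close>] R(1) by simp
    then have "Min (?F ` {1..k}) < std_normal_cdf (std_normal_quantile p_low - ereal ?r)"
      by (simp add: radius_gap_def)
    \<comment> \<open>The minimum over the finite nonempty set is attained, which supplies the
      \<open>t\<close> for \<open>certified_top_k\<close>.\<close>
    moreover have "Min (?F ` {1..k}) \<in> ?F ` {1..k}" using assms(2) by (intro Min_in) auto
    ultimately obtain t where t: "t \<in> {1..k}"
      "?F t < std_normal_cdf (std_normal_quantile p_low - ereal ?r)"
      by auto
    have "p_up (b 1) \<le> (\<Sum>j=1..t. p_up (b j))"
      using t(1) nonneg member_le_sum[of 1 "{1..t}" "\<lambda>j. p_up (b j)"] by auto
    then have "0 < (\<Sum>j=1..t. p_up (b j))" using nd by linarith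
    then show ?thesis
      using certified_top_k[OF assms(1,4,6,7) _ _ assms(10,11,12) t(1) _ t(2)] nd by blast
  qed
  ultimately show ?thesis by blast
qed

end
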